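(* Let $\mathbb{F}$ be an algebraically closed field with $\mathrm{Char}(\mathbb{F})\neq 2$ and let $L=\mathfrak{sl}_2(\mathbb{F})$. Let $a,a^*$ be a pair of normalized semisimple elements of $L$, and let $p\in\mathbb{F}$ be the corresponding parameter, i.e. $\langle a,a^*\rangle=1-2p$. Then $$[a,[a,a^*]]=4(2p-1)a+4a^*,\qquad [a^*,[a^*,a]]=4(2p-1)a^*+4a.$$
   Context: $L=\mathfrak{sl}_2(\mathbb{F})$ is the Lie algebra of trace-zero $2\times 2$ matrices over $\mathbb{F}$ with bracket $[u,v]=uv-vu$. The bilinear form $\langle u,v\rangle$ on $L$ is $\frac18$ times the Killing form; equivalently $\langle u,v\rangle=\mathrm{tr}(uv)/2$. Write $\|u\|^2=\langle u,u\rangle$. An element $u\in L$ is semisimple if $\mathrm{ad}\,u:L\to L$ is diagonalizable; a semisimple $u$ is normalized if $\|u\|^2=1$. *)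

theory Defs
  imports "HOL-Analysis.Analysis" "HOL-Computational_Algebra.Polynomial"
begin

(* The library's *s scales column vectors only; matrices need their own vector space structure. *)

definition mat_smult :: "'a::times \<Rightarrow> 'a^'n^'m \<Rightarrow> 'a^'n^'m"  (infixr \<open>*m\<close> 75)
  where "c *m A = (\<chi> i j. c * A $ i $ j)"

interpretation matvs: vector_space "mat_smult :: 'a::field \<Rightarrow> 'a^'n^'m \<Rightarrow> 'a^'n^'m"
  by unfold_locales (simp_all add: mat_smult_def vec_eq_iff algebra_simps)

definition sl2 :: "('a::field^2^2) set"
  where "sl2 = {u. trace u = 0}"

definition bracket :: "'a::field^2^2 \<Rightarrow> 'a^2^2 \<Rightarrow> 'a^2^2"
  where "bracket u v = u ** v - v ** u"

definition sl2_e :: "'a::field^2^2" where "sl2_e = vector [vector [0, 1], vector [0, 0]]"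
definition sl2_h :: "'a::field^2^2" where "sl2_h = vector [vector [1, 0], vector [0, -1]]"
definition sl2_f :: "'a::field^2^2" where "sl2_f = vector [vector [0, 0], vector [1, 0]]"

definition sl2_basis :: "('a::field^2^2) set"
  where "sl2_basis = {sl2_e, sl2_h, sl2_f}"

(* Trace of an endomorphism of sl2: the sum of the diagonal entries of its matrix in the standard
   basis.  That sl2_basis is a basis of sl2 is proved below, so representation is meaningful. *)

definition sl2_trace :: "('a::field^2^2 \<Rightarrow> 'a^2^2) \<Rightarrow> 'a"
  where "sl2_trace \<phi> = (\<Sum>b\<in>sl2_basis. matvs.representation sl2_basis (\<phi> b) b)"

definition killing_form :: "'a::field^2^2 \<Rightarrow> 'a^2^2 \<Rightarrow> 'a"
  where "killing_form u v = sl2_trace (bracket u \<circ> bracket v)"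

(* Normalised Killing form; meaningful in characteristic different from 2, where 8 is invertible. *)

definition sl2_form :: "'a::field^2^2 \<Rightarrow> 'a^2^2 \<Rightarrow> 'a"
  where "sl2_form u v = killing_form u v / 8"

definition diagonalizable_on :: "('a::field^2^2) set \<Rightarrow> ('a^2^2 \<Rightarrow> 'a^2^2) \<Rightarrow> bool"
  where "diagonalizable_on V \<phi> \<longleftrightarrow>
    (\<exists>B. matvs.independent B \<and> matvs.span B = V \<and> (\<forall>b\<in>B. \<exists>c. \<phi> b = c *m b))"

definition semisimple :: "'a::field^2^2 \<Rightarrow> bool"
  where "semisimple u \<longleftrightarrow> diagonalizable_on sl2 (bracket u)"

definition normalized :: "'a::field^2^2 \<Rightarrow> bool"
  where "normalized u \<longleftrightarrow> sl2_form u u = 1"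

lemmas sl2_entries = sl2_e_def sl2_h_def sl2_f_def mat_smult_def vec_eq_iff forall_2

lemma sl2_basis_distinct:
  "sl2_e \<noteq> sl2_h" "sl2_e \<noteq> sl2_f" "sl2_h \<noteq> sl2_f"
  by (simp_all add: sl2_entries)

lemma sl2_decomp:
  assumes "u \<in> sl2"
  shows "u = (u$1$2) *m sl2_e + (u$1$1) *m sl2_h + (u$2$1) *m sl2_f"
proof -
  have "u$2$2 = - (u$1$1)"
    using assms by (simp add: sl2_def trace_def sum_2 eq_neg_iff_add_eq_0 add.commute)
  then show ?thesis by (simp add: sl2_entries)
qed

lemma sum_sl2_basis: "(\<Sum>b\<in>sl2_basis. g b) = g sl2_e + g sl2_h + g sl2_f"
  by (simp add: sl2_basis_def sl2_basis_distinct add.assoc)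

lemma independent_sl2_basis: "matvs.independent (sl2_basis :: ('a::field^2^2) set)"
proof (rule matvs.independent_if_scalars_zero)
  show "finite (sl2_basis :: ('a^2^2) set)" by (simp add: sl2_basis_def)
next
  fix g :: "'a^2^2 \<Rightarrow> 'a" and x :: "'a^2^2"
  assume *: "(\<Sum>b\<in>sl2_basis. g b *m b) = 0" and x: "x \<in> sl2_basis"
  have "g sl2_e *m sl2_e + g sl2_h *m sl2_h + g sl2_f *m sl2_f = (0 :: 'a^2^2)"
    using * by (simp add: sum_sl2_basis)
  then have "g sl2_e = 0 \<and> g sl2_h = 0 \<and> g sl2_f = 0"
    by (simp add: mat_smult_def vec_eq_iff forall_2)
       (simp add: sl2_e_def sl2_h_def sl2_f_def)
  then show "g x = 0"
    using x by (auto simp: sl2_basis_def)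
qed

lemma span_sl2_basis: "matvs.span sl2_basis = (sl2 :: ('a::field^2^2) set)"
proof
  have "matvs.subspace (sl2 :: ('a^2^2) set)"
    by (simp add: matvs.subspace_def sl2_def trace_add)
       (simp add: trace_def sum_2 mat_smult_def flip: distrib_left)
  moreover have "sl2_basis \<subseteq> (sl2 :: ('a^2^2) set)"
    by (simp add: sl2_basis_def sl2_def trace_def sum_2 sl2_e_def sl2_h_def sl2_f_def)
  ultimately show "matvs.span sl2_basis \<subseteq> (sl2 :: ('a^2^2) set)"
    by (intro matvs.span_minimal)
next
  show "sl2 \<subseteq> matvs.span (sl2_basis :: ('a^2^2) set)"
  proof
    fix u :: "'a^2^2" assume "u \<in> sl2"
    have "(u$1$2) *m sl2_e + (u$1$1) *m sl2_h + (u$2$1) *m sl2_f \<in> matvs.span sl2_basis"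
      by (intro matvs.span_add matvs.span_scale matvs.span_base) (simp_all add: sl2_basis_def)
    then show "u \<in> matvs.span sl2_basis"
      unfolding sl2_decomp[OF \<open>u \<in> sl2\<close>, symmetric] .
  qed
qed

lemma representation_sl2_basis:
  assumes "u \<in> sl2"
  shows "matvs.representation sl2_basis u sl2_e = u$1$2"
    and "matvs.representation sl2_basis u sl2_h = u$1$1"
    and "matvs.representation sl2_basis u sl2_f = u$2$1"
proof -
  let ?r = "matvs.representation sl2_basis u"
  have "(\<Sum>b\<in>sl2_basis. ?r b *m b) = u"
    by (rule matvs.sum_representation_eq[OF independent_sl2_basis])
       (simp_all add: span_sl2_basis assms, simp add: sl2_basis_def)
  then have eq: "?r sl2_e *m sl2_e + ?r sl2_h *m sl2_h + ?r sl2_f *m sl2_f = u"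
    by (simp add: sum_sl2_basis)
  show "?r sl2_e = u$1$2"
    using arg_cong[OF eq, of "\<lambda>m. m$1$2"]
    by (simp add: mat_smult_def) (simp add: sl2_e_def sl2_h_def sl2_f_def)
  show "?r sl2_h = u$1$1"
    using arg_cong[OF eq, of "\<lambda>m. m$1$1"]
    by (simp add: mat_smult_def) (simp add: sl2_e_def sl2_h_def sl2_f_def)
  show "?r sl2_f = u$2$1"
    using arg_cong[OF eq, of "\<lambda>m. m$2$1"]
    by (simp add: mat_smult_def) (simp add: sl2_e_def sl2_h_def sl2_f_def)
qed

lemma bracket_in_sl2: "bracket u v \<in> sl2"
  using trace_mul_sym[of u v] by (simp add: sl2_def bracket_def trace_sub)

lemma killing_form_eq_trace:
  assumes "u \<in> sl2" "v \<in> sl2"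
  shows "killing_form u v = 4 * trace (u ** v)"
proof -
  have "u$2$2 = - (u$1$1)" "v$2$2 = - (v$1$1)"
    using assms by (simp_all add: sl2_def trace_def sum_2 eq_neg_iff_add_eq_0 add.commute)
  then show ?thesis
    by (simp add: killing_form_def sl2_trace_def sum_sl2_basis representation_sl2_basis
          bracket_in_sl2)
       (simp add: bracket_def matrix_matrix_mult_def sum_2 trace_def
          sl2_e_def sl2_h_def sl2_f_def algebra_simps)
qed

lemma sl2_form_eq_trace:
  fixes u v :: "'a::field^2^2"
  assumes "CHAR('a) \<noteq> 2" "u \<in> sl2" "v \<in> sl2"
  shows "sl2_form u v = trace (u ** v) / 2"
proof -
  have two: "(2::'a) \<noteq> 0"
  proof
    assume "(2::'a) = 0"
    then have "of_nat 2 = (0::'a)" by simp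
    then have "CHAR('a) dvd 2" by (simp only: of_nat_eq_0_iff_char_dvd)
    moreover have "CHAR('a) \<noteq> 1" by simp
    ultimately show False using assms(1) prime_nat_iff two_is_prime_nat by blast
  qed
  then have "(4::'a) \<noteq> 0"
    using mult_eq_0_iff[of "2::'a" 2] by simp
  then have "(4 * trace (u ** v)) / (4 * 2) = trace (u ** v) / 2"
    by (rule mult_divide_mult_cancel_left)
  moreover have "4 * 2 = (8::'a)"
    by simp
  ultimately show ?thesis
    by (simp only: sl2_form_def killing_form_eq_trace assms(2,3))
qed

end

theory Submission
  imports Defs
begin

text \<open>For trace-zero 2x2 matrices, polarized Cayley-Hamilton reads
  \<open>uv + vu = tr(uv) I\<close>. Eliminating \<open>uvu\<close> from
  \<open>[u,[u,v]] = u^2 v - 2uvu + v u^2\<close> gives \<open>4<u,u> v - 4<u,v> u\<close>, which is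
  \<open>bracket_bracket_sl2_form\<close>. Both identities are instances with unit norms; symmetry
  of the form supplies the second inner product.\<close>

lemma sl2_entry_22: "u \<in> sl2 \<Longrightarrow> u$2$2 = - (u$1$1)"
  by (simp add: sl2_def trace_def sum_2 eq_neg_iff_add_eq_0 add.commute)

text \<open>Phrased with traces and no division, this is a polynomial identity in the entries once
  trace zero eliminates the (2,2) entries, so it can be checked entry by entry in every
  characteristic.\<close>

lemma bracket_bracket_trace:
  assumes "u \<in> sl2" "v \<in> sl2"
  shows "bracket u (bracket u v) = (2 * trace (u ** u)) *m v - (2 * trace (u ** v)) *m u"
  by (simp add: vec_eq_iff forall_2 bracket_def matrix_matrix_mult_def sum_2 trace_def
        mat_smult_def sl2_entry_22[OF assms(1)] sl2_entry_22[OF assms(2)])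
     (simp add: algebra_simps)

lemma two_neq_0_field:
  assumes "CHAR('a::field) \<noteq> 2"
  shows "(2::'a) \<noteq> 0"
proof
  assume "(2::'a) = 0"
  then have "of_nat 2 = (0::'a)" by simp
  then have "CHAR('a) dvd 2" by (simp only: of_nat_eq_0_iff_char_dvd)
  \<comment> \<open>A divisor of the prime 2 is 1 or 2, and both are excluded.\<close>
  moreover have "CHAR('a) \<noteq> 1" by simp
  ultimately show False using assms prime_nat_iff two_is_prime_nat by blast
qed

lemma trace_eq_sl2_form:
  fixes u v :: "'a::field^2^2"
  assumes "CHAR('a) \<noteq> 2" "u \<in> sl2" "v \<in> sl2"
  shows "trace (u ** v) = 2 * sl2_form u v"
  using two_neq_0_field[OF assms(1)] by (simp add: sl2_form_eq_trace[OF assms])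

lemma bracket_bracket_sl2_form:
  fixes u v :: "'a::field^2^2"
  assumes "CHAR('a) \<noteq> 2" "u \<in> sl2" "v \<in> sl2"
  shows "bracket u (bracket u v) = (4 * sl2_form u u) *m v - (4 * sl2_form u v) *m u"
  using assms by (simp add: bracket_bracket_trace trace_eq_sl2_form)

lemma sl2_form_commute:
  fixes u v :: "'a::field^2^2"
  assumes "CHAR('a) \<noteq> 2" "u \<in> sl2" "v \<in> sl2"
  shows "sl2_form u v = sl2_form v u"
  using assms by (simp add: sl2_form_eq_trace trace_mul_sym[of u v])

theorem lemma2p12:
  fixes a a' :: "'a::alg_closed_field^2^2" and p :: 'a
  assumes "CHAR('a) \<noteq> 2"
    and "a \<in> sl2" and "a' \<in> sl2"
    and "semisimple a" and "semisimple a'"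
    and "normalized a" and "normalized a'"
    and "sl2_form a a' = 1 - 2 * p"
  shows "bracket a (bracket a a') = (4 * (2 * p - 1)) *m a + 4 *m a'
       \<and> bracket a' (bracket a' a) = (4 * (2 * p - 1)) *m a' + 4 *m a"
proof -
  have "sl2_form a' a = 1 - 2 * p"
    using sl2_form_commute[OF assms(1-3)] assms(8) by simp
  \<comment> \<open>Absorbs the minus sign through \<open>-(1 - 2 * p) = 2 * p - 1\<close>; general
    in \<open>u\<close> and \<open>v\<close> so that it serves both identities.\<close>
  moreover have "4 *m v - (4 * (1 - 2 * p)) *m u = (4 * (2 * p - 1)) *m u + 4 *m v"
    for u v :: "'a^2^2"
    by (simp add: mat_smult_def vec_eq_iff algebra_simps)
  ultimately show ?thesis
    using assms(6-8) by (simp add: bracket_bracket_sl2_form assms(1-3) normalized_def)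
qed

end
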